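(* Let $f:\mathbb{R}^n\to\mathbb{R}$ and $h:\mathbb{R}^n\to(-\infty,\infty]$, $\varphi=f+h$, satisfy: $f$ is twice continuously differentiable and $\nabla f$ is Lipschitz continuous with modulus $L>0$; $h$ is proper, closed, and strongly prox-regular with respect to a compact set $\mathcal{C}\supset\operatorname{dom}(h)$ and a constant $\gamma>0$; $\varphi$ is bounded from below and coercive (all its sublevel sets are bounded). Let $t\in(0,\min(\gamma,1)/L]$ be fixed, and let $\{x^k\}$ be generated by the projected semismooth Newton method (described in the context) with this $t$. Then $$\lim_{k\to\infty}\|F(x^k)\|=0,\qquad\text{where } F(x)=x-\mathrm{prox}_{th}(x-t\nabla f(x)).$$
   Context: Proximal operator: $\mathrm{prox}_{th}(x)=\operatorname{arg\,min}_u\{th(u)+\frac12\|x-u\|^2\}$, $\|\cdot\|$ Euclidean. Strong prox-regularity of $h$ with respect to compact $\mathcal{C}\supset\operatorname{dom}(h)$ and $\gamma>0$ (and some norm $N$ on $\mathbb{R}^n$): for every $t\in(0,\gamma]$, $\mathrm{prox}_{th}$ is single-valued, Lipschitz continuous and monotone over $\{x+sv: x\in\mathcal{C},\ N(v)=1,\ 0\le s\le\gamma\}$. Standing convention: for the chosen $t$, $\mathrm{prox}_{th}$ is single-valued and Lipschitz continuous on an open set containing $\{x-t\nabla f(x): x\in\mathcal{C}\cup\{x^0\}\}$, so that $F(x)=x-\mathrm{prox}_{th}(x-t\nabla f(x))$ is single-valued and Lipschitz continuous on $\mathcal{C}\cup\{x^0\}$; and $F$ is semismooth, i.e. directionally differentiable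 with $\|F(x+d)-F(x)-Jd\|=o(\|d\|)$ as $d\to 0$ for $J$ in the generalized Jacobian at $x+d$. Generalized Jacobian used by the method: $M(x)=\{I-D(I-t\nabla^2f(x)): D\in D(x)\}$, where $D(x)$ is the B-subdifferential of $\mathrm{prox}_{th}$ at $x-t\nabla f(x)$; the B-subdifferential of a locally Lipschitz map $G$ at $y$ is $\partial_BG(y)=\{\lim_k G'(y^k): y^k\to y,\ G\text{ differentiable at }y^k\}$. Projected semismooth Newton method: constants $\nu\in(0,1)$, $q\in(0,1)$, $\eta>0$, $\rho_0>0$, $\kappa>0$; initial point $x^0\in\mathbb{R}^n$. For $k=0,1,2,\dots$: choose $M^k\in M(x^k)$, set $\mu_k=\kappa\|F(x^k)\|$, let $d^k$ be a solution of $(M^k+\mu_kI)d^k=-F(x^k)$, and let $z^k=\mathcal{P}_{\operatorname{dom}(h)}(x^k+d^k)$ be a nearest point of $\operatorname{dom}(h)$ to $x^k+d^k$. If both $\|F(z^k)\|\le\nu\rho_k$ and $\varphi(z^k)\le\varphi(x^k)+\eta\rho_k^{1-q}\|F(z^k)\|^q$ hold, the Newton update is accepted: $x^{k+1}=z^k$ and $\rho_{k+1}=\|F(x^{k+1})\|$. Otherwise a proximal gradient step is made: $x^{k+1}=x^k-F(x^k)=\mathrm{prox}_{th}(x^k-t\nabla f(x^k))$ and $\rho_{k+1}=\rho_k$. (So $\rho_k$ is the residual norm of the last accepted Newton iterate up to $k$.) The algorithm is assumed to run so as to produce an infinite sequence. *)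

theory Defs
  imports "HOL-Analysis.Analysis"
begin

section \<open>Extended-valued functions\<close>

definition edom :: "('a \<Rightarrow> ereal) \<Rightarrow> 'a set" where
  "edom h = {x. h x < \<infinity>}"

definition proper_fun :: "('a \<Rightarrow> ereal) \<Rightarrow> bool" where
  "proper_fun h \<longleftrightarrow> (\<forall>x. h x \<noteq> -\<infinity>) \<and> edom h \<noteq> {}"

definition closed_fun :: "('a::topological_space \<Rightarrow> ereal) \<Rightarrow> bool" where
  "closed_fun h \<longleftrightarrow> closed {(x, r :: real). h x \<le> ereal r}"

definition bounded_below_fun :: "('a \<Rightarrow> ereal) \<Rightarrow> bool" where
  "bounded_below_fun \<phi> \<longleftrightarrow> (\<exists>m :: real. \<forall>x. ereal m \<le> \<phi> x)"

definition coercive_fun :: "('a::metric_space \<Rightarrow> ereal) \<Rightarrow> bool" where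
  "coercive_fun \<phi> \<longleftrightarrow> (\<forall>c :: real. bounded {x. \<phi> x \<le> ereal c})"

section \<open>Proximal operator and strong prox-regularity\<close>

definition prox_set :: "real \<Rightarrow> ('a::euclidean_space \<Rightarrow> ereal) \<Rightarrow> 'a \<Rightarrow> 'a set" where
  "prox_set t h x =
     {u. is_arg_min (\<lambda>u. ereal t * h u + ereal ((norm (x - u))\<^sup>2 / 2)) (\<lambda>_. True) u}"

definition prox_single_valued_on :: "real \<Rightarrow> ('a::euclidean_space \<Rightarrow> ereal) \<Rightarrow> 'a set \<Rightarrow> bool" where
  "prox_single_valued_on t h S \<longleftrightarrow> (\<forall>x\<in>S. \<exists>!u. u \<in> prox_set t h x)"

text \<open>The value is meaningful only where the set of minimizers is a singleton.\<close>
definition prox :: "real \<Rightarrow> ('a::euclidean_space \<Rightarrow> ereal) \<Rightarrow> 'a \<Rightarrow> 'a" where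
  "prox t h x = (THE u. u \<in> prox_set t h x)"

text \<open>A norm as a function, possibly different from the Euclidean norm of the type;
  nonnegativity follows from the stated axioms.\<close>
definition is_norm :: "('a::real_vector \<Rightarrow> real) \<Rightarrow> bool" where
  "is_norm N \<longleftrightarrow>
     (\<forall>v. N v = 0 \<longleftrightarrow> v = 0) \<and>
     (\<forall>c v. N (c *\<^sub>R v) = \<bar>c\<bar> * N v) \<and>
     (\<forall>v w. N (v + w) \<le> N v + N w)"

definition strongly_prox_regular_wrt ::
    "('a::euclidean_space \<Rightarrow> real) \<Rightarrow> ('a \<Rightarrow> ereal) \<Rightarrow> 'a set \<Rightarrow> real \<Rightarrow> bool" where
  "strongly_prox_regular_wrt N h C \<gamma> \<longleftrightarrow>
     (\<forall>t\<in>{0<..\<gamma>}.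
        let S = {x + s *\<^sub>R v | x s v. x \<in> C \<and> N v = 1 \<and> 0 \<le> s \<and> s \<le> \<gamma>} in
          prox_single_valued_on t h S \<and>
          (\<exists>K. K-lipschitz_on S (prox t h)) \<and>
          (\<forall>y\<in>S. \<forall>z\<in>S. 0 \<le> (prox t h y - prox t h z) \<bullet> (y - z)))"

definition strongly_prox_regular ::
    "('a::euclidean_space \<Rightarrow> ereal) \<Rightarrow> 'a set \<Rightarrow> real \<Rightarrow> bool" where
  "strongly_prox_regular h C \<gamma> \<longleftrightarrow> (\<exists>N. is_norm N \<and> strongly_prox_regular_wrt N h C \<gamma>)"

section \<open>Generalized Jacobians and semismoothness\<close>

definition B_subdifferential :: "(real^'n \<Rightarrow> real^'m) \<Rightarrow> real^'n \<Rightarrow> (real^'n^'m) set" where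
  "B_subdifferential G x =
     {A. \<exists>y :: nat \<Rightarrow> real^'n. y \<longlonglongrightarrow> x \<and> (\<forall>k. G differentiable (at (y k))) \<and>
          (\<lambda>k. jacobian G (at (y k))) \<longlonglongrightarrow> A}"

text \<open>Clarke's generalized Jacobian.\<close>
definition clarke_jacobian :: "(real^'n \<Rightarrow> real^'m) \<Rightarrow> real^'n \<Rightarrow> (real^'n^'m) set" where
  "clarke_jacobian G x = convex hull (B_subdifferential G x)"

definition directionally_differentiable_at ::
    "('a::real_normed_vector \<Rightarrow> 'b::real_normed_vector) \<Rightarrow> 'a \<Rightarrow> bool" where
  "directionally_differentiable_at G x \<longleftrightarrow>
     (\<forall>d. \<exists>l. ((\<lambda>s. (G (x + s *\<^sub>R d) - G x) /\<^sub>R s) \<longlongrightarrow> l) (at_right 0))"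

definition semismooth_at :: "(real^'n \<Rightarrow> real^'m) \<Rightarrow> real^'n \<Rightarrow> bool" where
  "semismooth_at G x \<longleftrightarrow>
     directionally_differentiable_at G x \<and>
     (\<forall>\<epsilon>>0. \<exists>\<delta>>0. \<forall>d. norm d < \<delta> \<longrightarrow>
        (\<forall>J\<in>clarke_jacobian G (x + d). norm (G (x + d) - G x - J *v d) \<le> \<epsilon> * norm d))"

section \<open>Projected semismooth Newton iteration\<close>

text \<open>Below, \<open>gf\<close> and \<open>Hf\<close> stand for the gradient and the Hessian of the smooth part.\<close>

definition prox_residual ::
    "real \<Rightarrow> ('a::euclidean_space \<Rightarrow> 'a) \<Rightarrow> ('a \<Rightarrow> ereal) \<Rightarrow> 'a \<Rightarrow> 'a" where
  "prox_residual t gf h x = x - prox t h (x - t *\<^sub>R gf x)"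

definition newton_matrices ::
    "real \<Rightarrow> (real^'n \<Rightarrow> real^'n) \<Rightarrow> (real^'n \<Rightarrow> real^'n^'n) \<Rightarrow> (real^'n \<Rightarrow> ereal) \<Rightarrow>
     real^'n \<Rightarrow> (real^'n^'n) set" where
  "newton_matrices t gf Hf h x =
     {mat 1 - D ** (mat 1 - t *\<^sub>R Hf x) | D. D \<in> B_subdifferential (prox t h) (x - t *\<^sub>R gf x)}"

definition nearest_point :: "'a::metric_space set \<Rightarrow> 'a \<Rightarrow> 'a \<Rightarrow> bool" where
  "nearest_point S y z \<longleftrightarrow> z \<in> S \<and> (\<forall>u\<in>S. dist y z \<le> dist y u)"

text \<open>\<open>x\<close> and \<open>\<rho>\<close> are the iterates and the reference residuals produced by a run in which the
  generalized Jacobian elements, the Newton directions and the projections are chosen arbitrarily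
  among the admissible ones.\<close>
definition projected_semismooth_newton ::
    "(real^'n \<Rightarrow> real) \<Rightarrow> (real^'n \<Rightarrow> real^'n) \<Rightarrow> (real^'n \<Rightarrow> real^'n^'n) \<Rightarrow> (real^'n \<Rightarrow> ereal) \<Rightarrow>
     real \<Rightarrow> real \<Rightarrow> real \<Rightarrow> real \<Rightarrow> real \<Rightarrow> real \<Rightarrow> (nat \<Rightarrow> real^'n) \<Rightarrow> (nat \<Rightarrow> real) \<Rightarrow> bool" where
  "projected_semismooth_newton f gf Hf h t \<nu> q \<eta> \<rho>0 \<kappa> x \<rho> \<longleftrightarrow>
     (let F = prox_residual t gf h; \<phi> = (\<lambda>y. ereal (f y) + h y) in
        \<rho> 0 = \<rho>0 \<and>
        (\<forall>k. \<exists>M d z.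
           M \<in> newton_matrices t gf Hf h (x k) \<and>
           (M + mat (\<kappa> * norm (F (x k)))) *v d = - F (x k) \<and>
           nearest_point (edom h) (x k + d) z \<and>
           (if norm (F z) \<le> \<nu> * \<rho> k \<and>
               \<phi> z \<le> \<phi> (x k) + ereal (\<eta> * \<rho> k powr (1 - q) * norm (F z) powr q)
            then x (Suc k) = z \<and> \<rho> (Suc k) = norm (F (x (Suc k)))
            else x (Suc k) = x k - F (x k) \<and> \<rho> (Suc k) = \<rho> k)))"

end

theory Submission
  imports Defs
begin

text \<open>Testing the minimality of the proximal point at \<open>y + w\<close>, with \<open>w\<close> a small multiple of
  \<open>u - prox t h y\<close>, shows that the Lipschitz continuity of \<open>prox t h\<close> near \<open>y\<close> forces
  \<open>t h(u) + \<parallel>y - u\<parallel>\<^sup>2/2\<close> to grow quadratically away from its minimizer. Hence a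
  proximal gradient step decreases \<open>\<phi>\<close> by at least \<open>c \<parallel>F(x\<^sup>k)\<parallel>\<^sup>2\<close>, even
  for \<open>t = 1/L\<close>. As \<open>\<rho>\<^sub>k \<le> (\<rho>\<^sub>k - \<rho>\<^sub>k\<^sub>+\<^sub>1)/(1 - \<nu>)\<close> at every accepted Newton
  step, \<open>\<phi>(x\<^sup>k) + \<eta>/(1 - \<nu>) \<rho>\<^sub>k\<close> is a Lyapunov function, and its decrements together
  with those of \<open>\<rho>\<close> control the residual at the next iterate, by the Lipschitz continuity
  of \<open>F\<close>.\<close>

section \<open>Proximal gradient steps\<close>

text \<open>The descent lemma, obtained without integration: along the ray from \<open>x\<close>
  through \<open>y\<close>, the function \<open>\<psi>\<close> is \<open>f\<close> minus its
  quadratic model, up to a constant. Cauchy-Schwarz and the Lipschitz bound make its derivative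
  nonpositive for \<open>s\<close> at least 0.\<close>

lemma gradient_lipschitz_upper_bound:
  fixes f :: "'a::euclidean_space \<Rightarrow> real"
  assumes gradient: "\<And>y. GDERIV f y :> gf y"
    and lip: "L-lipschitz_on UNIV gf"
  shows "f y \<le> f x + gf x \<bullet> (y - x) + L / 2 * (norm (y - x))\<^sup>2"
proof -
  define d where "d = y - x"
  define \<psi> where "\<psi> s = f (x + s *\<^sub>R d) - s * (gf x \<bullet> d) - L / 2 * s\<^sup>2 * (norm d)\<^sup>2" for s
  have deriv: "(\<psi> has_real_derivative
      (gf (x + s *\<^sub>R d) - gf x) \<bullet> d - L * s * (norm d)\<^sup>2) (at s)" for s
  proof -
    have "(f has_derivative (\<lambda>v. v \<bullet> gf (x + s *\<^sub>R d))) (at (x + s *\<^sub>R d))"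
      using gradient by (simp add: gderiv_def)
    moreover have "((\<lambda>s. x + s *\<^sub>R d) has_derivative (\<lambda>r. r *\<^sub>R d)) (at s)"
      by (auto intro!: derivative_eq_intros)
    ultimately have "((\<lambda>s. f (x + s *\<^sub>R d)) has_derivative
        (\<lambda>r. (r *\<^sub>R d) \<bullet> gf (x + s *\<^sub>R d))) (at s)"
      by (rule has_derivative_compose[rotated])
    then have "((\<lambda>s. f (x + s *\<^sub>R d)) has_real_derivative gf (x + s *\<^sub>R d) \<bullet> d) (at s)"
      by (simp add: has_field_derivative_def inner_commute mult.commute[of _ "_ \<bullet> _"])
    then show ?thesis
      unfolding \<psi>_def by (auto intro!: derivative_eq_intros simp: inner_diff_left)
  qed
  have nonpos: "(gf (x + s *\<^sub>R d) - gf x) \<bullet> d - L * s * (norm d)\<^sup>2 \<le> 0" if "0 \<le> s" for s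
  proof -
    have "(gf (x + s *\<^sub>R d) - gf x) \<bullet> d \<le> norm (gf (x + s *\<^sub>R d) - gf x) * norm d"
      by (rule norm_cauchy_schwarz)
    also have "\<dots> \<le> (L * (s * norm d)) * norm d"
      using lipschitz_onD[OF lip, of "x + s *\<^sub>R d" x] that
      by (intro mult_right_mono) (simp_all add: dist_norm)
    finally show ?thesis by (simp add: power2_eq_square mult.assoc)
  qed
  have "\<psi> 1 \<le> \<psi> 0"
    using deriv nonpos by (intro DERIV_nonpos_imp_nonincreasing[of 0 1 \<psi>]) (simp, metis)
  then show ?thesis by (simp add: \<psi>_def d_def)
qed

section \<open>Minimality of proximal points in real arithmetic\<close>

lemma edom_finite:
  assumes "proper_fun h" "u \<in> edom h"
  shows "ereal (real_of_ereal (h u)) = h u"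
  using assms by (cases "h u") (auto simp: proper_fun_def edom_def)

lemma prox_set_subset_edom:
  assumes "proper_fun h" "0 < t"
  shows "prox_set t h y \<subseteq> edom h"
proof
  fix u assume u: "u \<in> prox_set t h y"
  obtain w where w: "w \<in> edom h" using assms by (auto simp: proper_fun_def)
  have "ereal t * h u + ereal ((norm (y - u))\<^sup>2 / 2) \<le> ereal t * h w + ereal ((norm (y - w))\<^sup>2 / 2)"
    using u by (auto simp: prox_set_def is_arg_min_def not_less)
  also have "\<dots> < \<infinity>"
    using edom_finite[OF assms(1) w, symmetric] by (metis less_ereal.simps(4) plus_ereal.simps(1) times_ereal.simps(1))
  finally show "u \<in> edom h" using assms(2) by (cases "h u") (auto simp: edom_def)
qed

lemma prox_set_le:
  assumes "proper_fun h" "0 < t" "u \<in> prox_set t h y" "w \<in> edom h"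
  shows "t * real_of_ereal (h u) + (norm (y - u))\<^sup>2 / 2
       \<le> t * real_of_ereal (h w) + (norm (y - w))\<^sup>2 / 2"
proof -
  have "u \<in> edom h" using assms prox_set_subset_edom by blast
  then have "h u = ereal (real_of_ereal (h u))" "h w = ereal (real_of_ereal (h w))"
    using assms edom_finite by metis+
  moreover have "ereal t * h u + ereal ((norm (y - u))\<^sup>2 / 2)
      \<le> ereal t * h w + ereal ((norm (y - w))\<^sup>2 / 2)"
    using assms(3) by (auto simp: prox_set_def is_arg_min_def not_less)
  ultimately show ?thesis
    by (metis ereal_less_eq(3) plus_ereal.simps(1) times_ereal.simps(1))
qed

lemma prox_in_prox_set:
  assumes "prox_single_valued_on t h U" "y \<in> U"
  shows "prox t h y \<in> prox_set t h y"
  using assms theI'[of "\<lambda>u. u \<in> prox_set t h y"] by (simp add: prox_def prox_single_valued_on_def)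

text \<open>Minimality of \<open>p\<close> at \<open>y\<close> is tested with \<open>p'\<close>, and
  minimality of \<open>p'\<close> at \<open>y + w\<close> with \<open>u\<close>. Adding the two
  cancels all terms at \<open>p'\<close> except an inner product, leaving the gain
  \<open>w \<bullet> (u - p')\<close>. Its main part \<open>w \<bullet> (u - p)\<close> is
  \<open>s\<close> times the squared distance from \<open>u\<close> to \<open>p\<close>; since
  \<open>K * s\<close> is at most 1/2, the error \<open>w \<bullet> (p' - p)\<close> costs at most
  half of that.\<close>

lemma prox_quadratic_growth:
  assumes "proper_fun h" "0 < t"
    and sv: "prox_single_valued_on t h U" and lip: "K-lipschitz_on U (prox t h)"
    and "y \<in> U" "u \<in> edom h" and step: "y + s *\<^sub>R (u - prox t h y) \<in> U"
    and s: "0 \<le> s" "K * s \<le> 1 / 2"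
  shows "t * real_of_ereal (h (prox t h y)) + (norm (y - prox t h y))\<^sup>2 / 2
           + s / 2 * (norm (u - prox t h y))\<^sup>2
       \<le> t * real_of_ereal (h u) + (norm (y - u))\<^sup>2 / 2"
proof -
  define p where "p = prox t h y"
  define w where "w = s *\<^sub>R (u - p)"
  define p' where "p' = prox t h (y + w)"
  have mem: "p \<in> prox_set t h y" "p' \<in> prox_set t h (y + w)"
    using assms by (auto simp: p_def p'_def w_def intro: prox_in_prox_set)
  then have "p' \<in> edom h" using assms prox_set_subset_edom by blast
  then have 1: "t * real_of_ereal (h p) + (norm (y - p))\<^sup>2 / 2
      \<le> t * real_of_ereal (h p') + (norm (y - p'))\<^sup>2 / 2"
    using assms mem by (intro prox_set_le) auto
  have 2: "t * real_of_ereal (h p') + (norm (y + w - p'))\<^sup>2 / 2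
      \<le> t * real_of_ereal (h u) + (norm (y + w - u))\<^sup>2 / 2"
    using assms mem by (intro prox_set_le) auto
  \<comment> \<open>Moving the centre by \<open>w\<close> changes the squared distance by a term
    affine in \<open>a\<close>, and the constant \<open>(norm w)\<^sup>2\<close> is the same on both
    sides of fact 2.\<close>
  have expand: "(norm (y + w - a))\<^sup>2 = (norm (y - a))\<^sup>2 + 2 * (w \<bullet> (y - a)) + (norm w)\<^sup>2" for a
    by (simp add: power2_norm_eq_inner algebra_simps inner_commute)
  have "w \<bullet> (p' - p) \<le> norm w * norm (p' - p)"
    by (rule norm_cauchy_schwarz)
  also have "\<dots> \<le> norm w * (K * norm w)"
    using lipschitz_onD[OF lip step \<open>y \<in> U\<close>]
    by (intro mult_left_mono) (simp_all add: dist_norm p'_def p_def w_def)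
  also have "\<dots> = (K * s) * (s * (norm (u - p))\<^sup>2)"
    using s by (simp add: w_def power2_eq_square)
  also have "\<dots> \<le> (1 / 2) * (s * (norm (u - p))\<^sup>2)"
    using s by (intro mult_right_mono) auto
  finally have 3: "w \<bullet> (p' - p) \<le> s / 2 * (norm (u - p))\<^sup>2" by simp
  have "w \<bullet> (u - p) = s * (norm (u - p))\<^sup>2"
    by (simp add: w_def power2_norm_eq_inner)
  then have "t * real_of_ereal (h p) + (norm (y - p))\<^sup>2 / 2 + s / 2 * (norm (u - p))\<^sup>2
      \<le> t * real_of_ereal (h u) + (norm (y - u))\<^sup>2 / 2"
    using 1 2 3 unfolding expand inner_diff_right by argo
  then show ?thesis by (simp add: p_def)
qed

text \<open>Quadratic growth is applied with \<open>u = x\<close>. Its term \<open>n / 2\<close>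
  absorbs the curvature term \<open>t * L / 2 * n\<close> of the descent lemma because
  \<open>t * L\<close> is at most 1, so the extra \<open>s / 2 * n\<close> survives even when
  \<open>t * L = 1\<close>.\<close>

lemma prox_gradient_descent:
  fixes f :: "'a::euclidean_space \<Rightarrow> real"
  assumes gradient: "\<And>y. GDERIV f y :> gf y"
    and gf_lip: "L-lipschitz_on UNIV gf"
    and "proper_fun h" "0 < t" "t * L \<le> 1"
    and "prox_single_valued_on t h U" "K-lipschitz_on U (prox t h)"
    and y: "y = x - t *\<^sub>R gf x"
    and "y \<in> U" "x \<in> edom h" "y + s *\<^sub>R (x - prox t h y) \<in> U"
    and "0 \<le> s" "K * s \<le> 1 / 2"
  shows "f (prox t h y) + real_of_ereal (h (prox t h y))
       \<le> f x + real_of_ereal (h x) - s / (2 * t) * (norm (x - prox t h y))\<^sup>2"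
proof -
  define p where "p = prox t h y"
  define n where "n = (norm (p - x))\<^sup>2"
  have n: "(norm (x - p))\<^sup>2 = n" by (simp add: n_def norm_minus_commute)
  have growth: "t * real_of_ereal (h p) + (norm (y - p))\<^sup>2 / 2 + s / 2 * n
      \<le> t * real_of_ereal (h x) + (norm (y - x))\<^sup>2 / 2"
    using prox_quadratic_growth[of h t U K y x s] assms by (simp add: p_def n[symmetric])
  \<comment> \<open>As \<open>y - x\<close> equals \<open>- t *\<^sub>R gf x\<close>, the last
    summand is the squared distance on the right of \<open>growth\<close>, where it cancels.\<close>
  have "(norm (y - p))\<^sup>2 = n + 2 * t * (gf x \<bullet> (p - x)) + (norm (y - x))\<^sup>2"
    unfolding y n_def
    by (simp add: power2_norm_eq_inner algebra_simps inner_commute) (simp add: power2_eq_square)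
  from growth[unfolded this] have 1: "t * real_of_ereal (h p) + t * (gf x \<bullet> (p - x)) + n / 2 + s / 2 * n
      \<le> t * real_of_ereal (h x)" by argo
  have "t * f p \<le> t * (f x + gf x \<bullet> (p - x) + L / 2 * n)"
    unfolding n_def using gradient_lipschitz_upper_bound[OF gradient gf_lip] \<open>0 < t\<close> by simp
  moreover have "t * L * n \<le> n"
    using mult_right_mono[OF \<open>t * L \<le> 1\<close>, of n] by (simp add: n_def)
  ultimately have "t * (f p + real_of_ereal (h p)) \<le> t * (f x + real_of_ereal (h x)) - s / 2 * n"
    using 1 by (simp add: algebra_simps)
  also have "\<dots> = t * (f x + real_of_ereal (h x) - s / (2 * t) * n)"
    using \<open>0 < t\<close> by (simp add: field_simps)
  finally show ?thesis using \<open>0 < t\<close> by (simp add: p_def[symmetric] n)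
qed

lemma prox_residual_lipschitz:
  fixes gf :: "'a::euclidean_space \<Rightarrow> 'a"
  assumes gf_lip: "L-lipschitz_on UNIV gf" and lip: "K-lipschitz_on U (prox t h)" and "0 \<le> t"
    and sub: "(\<lambda>y. y - t *\<^sub>R gf y) ` S \<subseteq> U"
  shows "(1 + K * (1 + t * L))-lipschitz_on S (prox_residual t gf h)"
proof -
  have "(1 + \<bar>t\<bar> * L)-lipschitz_on S (\<lambda>y. y - t *\<^sub>R gf y)"
    using lipschitz_on_subset[OF gf_lip]
    by (intro lipschitz_on_diff lipschitz_on_cmult lipschitz_on_id) auto
  then have "(K * (1 + t * L))-lipschitz_on S (\<lambda>y. prox t h (y - t *\<^sub>R gf y))"
    using lipschitz_on_compose2[OF _ lipschitz_on_subset[OF lip sub]] \<open>0 \<le> t\<close> by auto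
  then show ?thesis
    unfolding prox_residual_def by (intro lipschitz_on_diff lipschitz_on_id)
qed

section \<open>Convergence of the residuals\<close>

text \<open>Here \<open>a\<close> stands for objective values, \<open>\<rho>\<close> for reference
  residuals and \<open>r\<close> for residuals. The first alternative of \<open>step\<close> models
  an accepted Newton step, the second a proximal gradient step. Nothing is assumed about how often
  each occurs.\<close>

lemma residuals_tendsto_zero:
  fixes a \<rho> r :: "nat \<Rightarrow> real"
  assumes \<nu>: "\<nu> \<in> {0<..<1}" and c: "0 < c" and "0 \<le> B" "0 \<le> \<eta>"
    and \<rho>_nonneg: "\<And>k. 0 \<le> \<rho> k" and r_nonneg: "\<And>k. 0 \<le> r k" and a_ge: "\<And>k. m \<le> a k"
    and step: "\<And>k. (r (Suc k) = \<rho> (Suc k) \<and> \<rho> (Suc k) \<le> \<nu> * \<rho> k \<and> a (Suc k) \<le> a k + \<eta> * \<rho> k) \<or>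
      (\<rho> (Suc k) = \<rho> k \<and> a (Suc k) \<le> a k - c * (r k)\<^sup>2 \<and> r (Suc k) \<le> B * r k)"
  shows "r \<longlonglongrightarrow> 0"
proof -
  define V where "V k = a k + \<eta> / (1 - \<nu>) * \<rho> k" for k
  \<comment> \<open>One bound for both alternatives: the first summand dominates the residual after
    a Newton step, the second after a gradient step. Both are always nonnegative, so no case split
    on the tail of the run is required.\<close>
  define b where "b k = (\<rho> k - \<rho> (Suc k)) / (1 - \<nu>) + B * sqrt ((V k - V (Suc k)) / c)" for k
  have key: "\<rho> (Suc k) \<le> \<rho> k \<and> V (Suc k) \<le> V k \<and> r (Suc k) \<le> b k" for k
    using step[of k]
  proof (elim disjE conjE)
    assume r: "r (Suc k) = \<rho> (Suc k)" and \<rho>: "\<rho> (Suc k) \<le> \<nu> * \<rho> k"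
      and a: "a (Suc k) \<le> a k + \<eta> * \<rho> k"
    have \<nu>\<rho>: "\<nu> * \<rho> k \<le> \<rho> k" using \<nu> \<rho>_nonneg by (simp add: mult_left_le_one_le)
    have *: "\<rho> k \<le> (\<rho> k - \<rho> (Suc k)) / (1 - \<nu>)"
      using \<nu> \<rho> by (simp add: field_simps)
    have "a (Suc k) \<le> a k + \<eta> * ((\<rho> k - \<rho> (Suc k)) / (1 - \<nu>))"
      using a mult_left_mono[OF * \<open>0 \<le> \<eta>\<close>] by simp
    then have V: "V (Suc k) \<le> V k"
      by (simp add: V_def diff_divide_distrib right_diff_distrib)
    then have "0 \<le> B * sqrt ((V k - V (Suc k)) / c)"
      using c \<open>0 \<le> B\<close> by simp
    then have "r (Suc k) \<le> b k" using r \<rho> \<nu>\<rho> * by (simp add: b_def)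
    with V \<rho> \<nu>\<rho> show ?thesis by simp
  next
    assume \<rho>: "\<rho> (Suc k) = \<rho> k" and a: "a (Suc k) \<le> a k - c * (r k)\<^sup>2"
      and r: "r (Suc k) \<le> B * r k"
    \<comment> \<open>With \<open>\<rho>\<close> unchanged, \<open>V\<close> falls by exactly as
      much as \<open>a\<close>.\<close>
    from a \<rho> have V: "c * (r k)\<^sup>2 \<le> V k - V (Suc k)" by (simp add: V_def)
    then have "(r k)\<^sup>2 \<le> (V k - V (Suc k)) / c" using c by (simp add: field_simps)
    then have "r k \<le> sqrt ((V k - V (Suc k)) / c)" by (rule real_le_rsqrt)
    then have "r (Suc k) \<le> b k"
      using r \<rho> mult_left_mono[OF _ \<open>0 \<le> B\<close>] by (fastforce simp: b_def)
    moreover have "0 \<le> c * (r k)\<^sup>2" using c by simp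
    ultimately show ?thesis using V \<rho> by linarith
  qed
  have "convergent \<rho>"
    using key \<rho>_nonneg by (meson convergent_def decseq_Suc_iff decseq_convergent)
  moreover have "m \<le> V k" for k
    using a_ge[of k] \<rho>_nonneg[of k] \<nu> \<open>0 \<le> \<eta>\<close> by (simp add: V_def add_increasing2)
  then have "convergent V"
    using key by (meson convergent_def decseq_Suc_iff decseq_convergent)
  ultimately obtain \<rho>' V' where lims: "\<rho> \<longlonglongrightarrow> \<rho>'" "V \<longlonglongrightarrow> V'"
    by (auto simp: convergent_def)
  \<comment> \<open>Successive differences of the convergent sequences \<open>\<rho>\<close> and
    \<open>V\<close> vanish; the limit is kept unsimplified to match the form of
    \<open>b\<close>.\<close>
  have "b \<longlonglongrightarrow> (\<rho>' - \<rho>') / (1 - \<nu>) + B * sqrt ((V' - V') / c)"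
    unfolding b_def using \<nu> c lims by (intro tendsto_intros LIMSEQ_Suc) auto
  then have "b \<longlonglongrightarrow> 0" by simp
  then have "(\<lambda>k. r (Suc k)) \<longlonglongrightarrow> 0"
    by (rule tendsto_sandwich[rotated 3]) (use key r_nonneg in auto)
  then show ?thesis by (rule LIMSEQ_imp_Suc)
qed

section \<open>Application to the projected semismooth Newton run\<close>

theorem theorem5p3:
  fixes f :: "real^'n \<Rightarrow> real"
    and gf :: "real^'n \<Rightarrow> real^'n"
    and Hf :: "real^'n \<Rightarrow> real^'n^'n"
    and h :: "real^'n \<Rightarrow> ereal"
    and C :: "(real^'n) set"
    and L \<gamma> t \<nu> q \<eta> \<rho>0 \<kappa> :: real
    and x :: "nat \<Rightarrow> real^'n"
    and \<rho> :: "nat \<Rightarrow> real"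
  assumes gradient: "\<And>y. GDERIV f y :> gf y"
    and hessian: "\<And>y. (gf has_derivative (\<lambda>d. Hf y *v d)) (at y)"
    and hessian_continuous: "continuous_on UNIV Hf"
    and L_pos: "0 < L"
    and gradient_lipschitz: "L-lipschitz_on UNIV gf"
    and h_proper: "proper_fun h"
    and h_closed: "closed_fun h"
    and C_compact: "compact C"
    and dom_subset: "edom h \<subseteq> C"
    and \<gamma>_pos: "0 < \<gamma>"
    and prox_regular: "strongly_prox_regular h C \<gamma>"
    and \<phi>_bounded_below: "bounded_below_fun (\<lambda>y. ereal (f y) + h y)"
    and \<phi>_coercive: "coercive_fun (\<lambda>y. ereal (f y) + h y)"
    and t_range: "t \<in> {0 <.. min \<gamma> 1 / L}"
    and prox_convention: "\<exists>U. open U \<and> (\<lambda>y. y - t *\<^sub>R gf y) ` (C \<union> {x 0}) \<subseteq> U \<and>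
           prox_single_valued_on t h U \<and> (\<exists>K. K-lipschitz_on U (prox t h))"
    and F_semismooth: "\<And>y. y \<in> C \<union> {x 0} \<Longrightarrow> semismooth_at (prox_residual t gf h) y"
    and \<nu>_range: "\<nu> \<in> {0<..<1}"
    and q_range: "q \<in> {0<..<1}"
    and \<eta>_pos: "0 < \<eta>"
    and \<rho>0_pos: "0 < \<rho>0"
    and \<kappa>_pos: "0 < \<kappa>"
    and iteration: "projected_semismooth_newton f gf Hf h t \<nu> q \<eta> \<rho>0 \<kappa> x \<rho>"
  shows "(\<lambda>k. norm (prox_residual t gf h (x k))) \<longlonglongrightarrow> 0"
proof -
  define F where "F = prox_residual t gf h"
  \<comment> \<open>\<open>real_of_ereal\<close> sends infinity to 0, so \<open>\<phi>\<close>
    represents the objective only on \<open>edom h\<close>, and is used only there.\<close>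
  define \<phi> where "\<phi> y = f y + real_of_ereal (h y)" for y
  have t: "0 < t" and tL: "t * L \<le> 1"
    using t_range L_pos by (auto simp: field_simps)
  obtain U K0 where U: "open U" "(\<lambda>y. y - t *\<^sub>R gf y) ` (C \<union> {x 0}) \<subseteq> U"
    and sv: "prox_single_valued_on t h U" and K0: "K0-lipschitz_on U (prox t h)"
    using prox_convention by blast
  \<comment> \<open>Adding 1 makes the modulus strictly positive, so that \<open>1 / (2 * K)\<close>
    is a genuine positive step.\<close>
  define K where "K = K0 + 1"
  have lip: "K-lipschitz_on U (prox t h)" and K: "0 < K"
    using K0 lipschitz_on_nonneg[OF K0] by (auto simp: K_def intro: lipschitz_on_mono)
  have gf_cont: "continuous_on S gf" for S
    using gradient_lipschitz lipschitz_on_continuous_on continuous_on_subset by blast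
  \<comment> \<open>Compactness gives one radius \<open>e\<close> valid at every gradient-step point
    of \<open>C\<close>, hence one \<open>s\<close> and one decrease constant for all later
    iterates.\<close>
  have "compact ((\<lambda>y. y - t *\<^sub>R gf y) ` C)"
    using C_compact gf_cont by (intro compact_continuous_image continuous_intros)
  then obtain e where e: "0 < e" "(\<Union>y\<in>(\<lambda>y. y - t *\<^sub>R gf y) ` C. ball y e) \<subseteq> U"
    using compact_subset_open_imp_ball_epsilon_subset[of _ U] U by blast
  obtain D where D: "0 < D" "\<And>y z. y \<in> C \<Longrightarrow> z \<in> C \<Longrightarrow> norm (y - z) \<le> D"
  proof -
    obtain D0 where "0 < D0" "\<And>y. y \<in> C \<Longrightarrow> norm y \<le> D0"
      using compact_imp_bounded[OF C_compact] by (auto simp: bounded_pos)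
    then show thesis
      using that[of "D0 + D0"] by (smt (verit) norm_triangle_ineq4)
  qed
  \<comment> \<open>The first entry secures \<open>K * s \<le> 1 / 2\<close>. The second keeps the
    perturbation of the prox argument below \<open>e\<close>, hence inside \<open>U\<close>, since
    \<open>D\<close> bounds distances within \<open>C\<close>.\<close>
  define s where "s = min (1 / (2 * K)) (e / (2 * D))"
  have s: "0 < s" "K * s \<le> 1 / 2" "s * D < e"
  proof -
    show "0 < s" using K e D by (simp add: s_def)
    have "K * s \<le> K * (1 / (2 * K))" using K by (intro mult_left_mono) (auto simp: s_def)
    then show "K * s \<le> 1 / 2" using K by simp
    have "s * D \<le> e / (2 * D) * D" using D by (intro mult_right_mono) (auto simp: s_def)
    then show "s * D < e" using D e by simp
  qed
  have prox_dom: "prox t h y \<in> edom h" if "y \<in> U" for y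
    using prox_in_prox_set[OF sv that] prox_set_subset_edom[OF h_proper t] by blast
  have descent: "\<phi> (y - F y) \<le> \<phi> y - s / (2 * t) * (norm (F y))\<^sup>2" if y: "y \<in> edom h" for y
  proof -
    define v where "v = y - t *\<^sub>R gf y"
    have yC: "y \<in> C" using y dom_subset by blast
    then have vU: "v \<in> U" using U by (auto simp: v_def)
    have "norm (y - prox t h v) \<le> D"
      using D yC prox_dom[OF vU] dom_subset by blast
    then have "s * norm (y - prox t h v) \<le> s * D"
      using s by (intro mult_left_mono) auto
    also note \<open>s * D < e\<close>
    finally have "norm (s *\<^sub>R (y - prox t h v)) < e"
      using s by simp
    then have "v + s *\<^sub>R (y - prox t h v) \<in> ball v e"
      by (simp add: dist_norm)
    then have "v + s *\<^sub>R (y - prox t h v) \<in> U"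
      using e(2) yC unfolding v_def by blast
    from prox_gradient_descent[OF gradient gradient_lipschitz h_proper t tL sv lip v_def vU y this]
    show ?thesis using s by (simp add: \<phi>_def F_def prox_residual_def v_def)
  qed
  obtain M where F_lip: "M-lipschitz_on C F"
    using prox_residual_lipschitz[OF gradient_lipschitz lip, of C] U t unfolding F_def by auto
  have M: "0 \<le> M" using F_lip by (rule lipschitz_on_nonneg)
  have \<rho>_0: "\<rho> 0 = \<rho>0"
    using iteration by (simp add: projected_semismooth_newton_def Let_def)
  have run: "\<exists>z. z \<in> edom h \<and>
      (norm (F z) \<le> \<nu> * \<rho> k \<and>
         ereal (f z) + h z \<le> ereal (f (x k)) + h (x k) +
           ereal (\<eta> * \<rho> k powr (1 - q) * norm (F z) powr q) \<and>
         x (Suc k) = z \<and> \<rho> (Suc k) = norm (F (x (Suc k)))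
       \<or> x (Suc k) = x k - F (x k) \<and> \<rho> (Suc k) = \<rho> k)" for k
  proof -
    obtain d z where "nearest_point (edom h) (x k + d) z"
        "if norm (F z) \<le> \<nu> * \<rho> k \<and> ereal (f z) + h z \<le> ereal (f (x k)) + h (x k) +
           ereal (\<eta> * \<rho> k powr (1 - q) * norm (F z) powr q)
         then x (Suc k) = z \<and> \<rho> (Suc k) = norm (F (x (Suc k)))
         else x (Suc k) = x k - F (x k) \<and> \<rho> (Suc k) = \<rho> k"
      using iteration unfolding projected_semismooth_newton_def Let_def F_def by blast
    then show ?thesis by (intro exI[of _ z]) (auto simp: nearest_point_def split: if_splits)
  qed
  have \<rho>_nonneg: "0 \<le> \<rho> k" for k
  proof (induction k)
    case 0
    then show ?case using \<rho>_0 \<rho>0_pos by simp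
  next
    case (Suc k)
    then show ?case using run[of k] by auto
  qed
  \<comment> \<open>The prox convention covers \<open>x 0\<close> separately. After that,
    projections and proximal values both lie in \<open>edom h\<close>, so induction keeps every
    iterate from index 1 on in \<open>C\<close>.\<close>
  have in_U: "x k - t *\<^sub>R gf (x k) \<in> U" if "k = 0 \<or> x k \<in> edom h" for k
    using that U dom_subset by auto
  have x_Suc_dom: "x (Suc k) \<in> edom h" if "k = 0 \<or> x k \<in> edom h" for k
    using run[of k] prox_dom[OF in_U[OF that]] by (auto simp: F_def prox_residual_def)
  have dom: "x (Suc k) \<in> edom h" for k
    by (induction k) (use x_Suc_dom in auto)
  have \<phi>_ereal: "ereal (f y) + h y = ereal (\<phi> y)" if "y \<in> edom h" for y
    using edom_finite[OF h_proper that] by (metis \<phi>_def plus_ereal.simps(1))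
  obtain m where m: "\<And>y. ereal m \<le> ereal (f y) + h y"
    using \<phi>_bounded_below by (auto simp: bounded_below_fun_def)
  \<comment> \<open>The shift by one is needed because \<open>x 0\<close> may lie outside \<open>edom h\<close>.\<close>
  have "(\<lambda>k. norm (F (x (Suc k)))) \<longlonglongrightarrow> 0"
  proof (rule residuals_tendsto_zero[where \<nu> = \<nu> and c = "s / (2 * t)" and B = "1 + M" and \<eta> = \<eta>
        and \<rho> = "\<lambda>k. \<rho> (Suc k)" and a = "\<lambda>k. \<phi> (x (Suc k))" and m = m])
    show "m \<le> \<phi> (x (Suc k))" for k
      using m \<phi>_ereal[OF dom] by (metis ereal_less_eq(3))
    fix k
    let ?r = "\<rho> (Suc k)"
    obtain z where z: "z \<in> edom h" and cases: "norm (F z) \<le> \<nu> * ?r \<and>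
         ereal (f z) + h z \<le> ereal (f (x (Suc k))) + h (x (Suc k)) +
           ereal (\<eta> * ?r powr (1 - q) * norm (F z) powr q) \<and>
         x (Suc (Suc k)) = z \<and> \<rho> (Suc (Suc k)) = norm (F (x (Suc (Suc k))))
       \<or> x (Suc (Suc k)) = x (Suc k) - F (x (Suc k)) \<and> \<rho> (Suc (Suc k)) = ?r"
      using run[of "Suc k"] by blast
    show "(norm (F (x (Suc (Suc k)))) = \<rho> (Suc (Suc k)) \<and> \<rho> (Suc (Suc k)) \<le> \<nu> * ?r \<and>
        \<phi> (x (Suc (Suc k))) \<le> \<phi> (x (Suc k)) + \<eta> * ?r) \<or>
      (\<rho> (Suc (Suc k)) = ?r \<and>
        \<phi> (x (Suc (Suc k))) \<le> \<phi> (x (Suc k)) - s / (2 * t) * (norm (F (x (Suc k))))\<^sup>2 \<and>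
        norm (F (x (Suc (Suc k)))) \<le> (1 + M) * norm (F (x (Suc k))))"
      using cases
    proof (elim disjE conjE)
      assume Fz: "norm (F z) \<le> \<nu> * ?r"
        and \<phi>z: "ereal (f z) + h z \<le> ereal (f (x (Suc k))) + h (x (Suc k)) +
           ereal (\<eta> * ?r powr (1 - q) * norm (F z) powr q)"
        and xz: "x (Suc (Suc k)) = z" "\<rho> (Suc (Suc k)) = norm (F (x (Suc (Suc k))))"
      have "\<phi> z \<le> \<phi> (x (Suc k)) + \<eta> * ?r powr (1 - q) * norm (F z) powr q"
        using \<phi>z unfolding \<phi>_ereal[OF z] \<phi>_ereal[OF dom] by simp
      \<comment> \<open>Replacing the residual by the larger \<open>?r\<close> collapses the
        weighted product in the acceptance test to \<open>?r\<close>. This includes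
        \<open>?r = 0\<close>, where \<open>0 powr a = 0\<close>.\<close>
      moreover have "norm (F z) \<le> ?r"
        using Fz \<nu>_range \<rho>_nonneg mult_left_le_one_le[of ?r \<nu>] by (auto intro: order_trans)
      then have "?r powr (1 - q) * norm (F z) powr q \<le> ?r powr (1 - q) * ?r powr q"
        using q_range by (intro mult_left_mono powr_mono2) auto
      moreover have "?r powr (1 - q) * ?r powr q = ?r"
        using \<rho>_nonneg[of "Suc k"] by (simp add: powr_add[symmetric])
      ultimately have \<phi>z': "\<phi> z \<le> \<phi> (x (Suc k)) + \<eta> * (?r powr (1 - q) * norm (F z) powr q)"
        and "?r powr (1 - q) * norm (F z) powr q \<le> ?r"
        by (simp_all add: mult.assoc)
      from this(2) have "\<eta> * (?r powr (1 - q) * norm (F z) powr q) \<le> \<eta> * ?r"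
        using \<eta>_pos by (intro mult_left_mono) auto
      with \<phi>z' have "\<phi> z \<le> \<phi> (x (Suc k)) + \<eta> * ?r"
        by (rule order_trans[OF _ add_left_mono])
      then show ?thesis using Fz xz by simp
    next
      assume x': "x (Suc (Suc k)) = x (Suc k) - F (x (Suc k))" and \<rho>': "\<rho> (Suc (Suc k)) = ?r"
      \<comment> \<open>A gradient step has length equal to the current residual, so
        \<open>F\<close> changes by at most \<open>M\<close> times it; the triangle inequality adds
        the 1.\<close>
      have "norm (F (x (Suc (Suc k)))) \<le> (1 + M) * norm (F (x (Suc k)))"
      proof -
        have "norm (F (x (Suc (Suc k))) - F (x (Suc k))) \<le> M * norm (F (x (Suc k)))"
          using lipschitz_onD[OF F_lip subsetD[OF dom_subset dom] subsetD[OF dom_subset dom],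
              of "Suc k" k]
          by (simp add: dist_norm x')
        then show ?thesis
          using norm_triangle_sub[of "F (x (Suc (Suc k)))" "F (x (Suc k))"]
          by (simp add: algebra_simps)
      qed
      then show ?thesis using \<rho>' descent[OF dom, of k] x' by simp
    qed
  qed (use \<nu>_range s t M \<eta>_pos \<rho>_nonneg in auto)
  then show ?thesis unfolding F_def by (rule LIMSEQ_imp_Suc)
qed

end
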